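(* Let $G$ be a group with finite symmetric generating set $A$ and let $(\mathcal N,c)$ be a stacking for $(G,A)$. If $R_c$ is the associated stacking relation set, then $\langle A\mid R_c\rangle$ is a finite presentation for $G$. Moreover, the set $\mathcal N$ of normal forms of a stacking is closed under taking prefixes.
   Context: Conventions. $A$ is closed under inversion (each $a\in A$ has a formal inverse $a^{-1}\in A$), and no element of $A$ represents the identity $\epsilon$ of $G$. In a presentation $\langle A\mid R\rangle$ the letters $a,a^{-1}\in A$ are understood to be mutually inverse. $A^*$ is the set of words over $A$; $1$ is the empty word; $v=w$ means equality as words and $v=_Gw$ means equality in $G$. $\Gamma$ is the Cayley graph of $G$ with respect to $A$, with directed edges $\vec E(\Gamma)$; $e_{g,a}$ is the directed edge labeled $a$ from $g$ to $ga$. A set of normal forms $\mathcal N=\{y_g\mid g\in G\}\subseteq A^*$ contains exactly one word $y_g$ representing each $g\in G$. The degenerate edges are $\vec E_d:=\{e_{g,a}\mid y_ga=y_{ga}\text{ or }y_g=y_{ga}a^{-1}\text{ as words}\}$; the recursive edges are $\vec E_r:=\vec E(\Gamma)\setminus\vec E_d$. For a function $c:\vec E_r\to A^*$, let $<_c$ be the transitive closure of the relation: $e'<_c e$ whenever $e,e'\in\vec E_r$ and $e'$ lies (with the direction of the path) on the path in $\Gamma$ starting at the initial vertex of $e$ and labeled $c(e)$. A stacking for $G$ with respect to $A$ is a pair $(\mathcal N,c)$ where $\mathcal N$ is a set of normal forms with $y_\epsilon=1$ and $c:\vec E_r\to A^*$ satisfies: (S1) $c(e_{g,a})=_Ga$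 for each $e_{g,a}\in\vec E_r$; (S2) $<_c$ is a strict partial ordering on $\vec E_r$ such that for each $e\in\vec E_r$ there are only finitely many $e''\in\vec E_r$ with $e''<_ce$; (S3) the image $c(\vec E_r)\subset A^*$ is finite. The stacking relation set $R_c$ is the closure of $\{c(e_{g,a})a^{-1}\mid e_{g,a}\in\vec E_r\}$ under inversion, cyclic conjugation, and free reduction (excluding the empty word). *)

theory Defs
  imports "HOL-Algebra.Coset" "HOL-Algebra.Generated_Groups" "HOL-Library.Sublist"
begin

definition word_value :: "('g, 'm) monoid_scheme \<Rightarrow> ('a \<Rightarrow> 'g) \<Rightarrow> 'a list \<Rightarrow> 'g" where
  "word_value G \<pi> w = foldr (\<lambda>a x. \<pi> a \<otimes>\<^bsub>G\<^esub> x) w \<one>\<^bsub>G\<^esub>"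

definition inverse_word :: "('a \<Rightarrow> 'a) \<Rightarrow> 'a list \<Rightarrow> 'a list" where
  "inverse_word \<iota> w = map \<iota> (rev w)"

text \<open>
  The letters form an alphabet \<open>A\<close> with formal inversion \<open>\<iota>\<close>, and \<open>\<pi> a\<close> is the group element
  represented by the letter \<open>a\<close>. Neither is \<open>\<pi>\<close> required to be injective on \<open>A\<close> nor \<open>\<iota>\<close> to be
  fixed-point free. An inverse-closed generating subset \<open>A\<close> of the group is the case
  where \<open>\<pi>\<close> is the identity and \<open>\<iota>\<close> is the group inverse.
\<close>

locale symmetric_generating_set = group G
  for G :: "('g, 'm) monoid_scheme" (structure) +
  fixes A :: "'a set" and \<iota> :: "'a \<Rightarrow> 'a" and \<pi> :: "'a \<Rightarrow> 'g"
  assumes letter_inverse_closed: "a \<in> A \<Longrightarrow> \<iota> a \<in> A"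
    and letter_inverse_involutive: "a \<in> A \<Longrightarrow> \<iota> (\<iota> a) = a"
    and letter_value_closed: "a \<in> A \<Longrightarrow> \<pi> a \<in> carrier G"
    and letter_value_inverse: "a \<in> A \<Longrightarrow> \<pi> (\<iota> a) = inv (\<pi> a)"
    and letter_value_not_one: "a \<in> A \<Longrightarrow> \<pi> a \<noteq> \<one>"
    and letters_generate: "generate G (\<pi> ` A) = carrier G"

inductive free_cancellation :: "('a \<Rightarrow> 'a) \<Rightarrow> 'a list \<Rightarrow> 'a list \<Rightarrow> bool" for \<iota> where
  "free_cancellation \<iota> (u @ [a, \<iota> a] @ v) (u @ v)"

definition free_eq :: "'a set \<Rightarrow> ('a \<Rightarrow> 'a) \<Rightarrow> ('a list \<times> 'a list) set" where
  "free_eq A \<iota> = {(u, v). u \<in> lists A \<and> v \<in> lists A \<and>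
     equivclp (\<lambda>x y. x \<in> lists A \<and> y \<in> lists A \<and> free_cancellation \<iota> x y) u v}"

text \<open>
  The free group on \<open>A\<close> in which the letters \<open>a\<close> and \<open>\<iota> a\<close> are mutually inverse: words
  over \<open>A\<close> modulo insertion and deletion of subwords \<open>a (\<iota> a)\<close>. (If \<open>\<iota> a = a\<close>, the letter
  \<open>a\<close> has order two.)
\<close>

definition free_group_on :: "'a set \<Rightarrow> ('a \<Rightarrow> 'a) \<Rightarrow> 'a list set monoid" where
  "free_group_on A \<iota> =
     \<lparr>carrier = lists A // free_eq A \<iota>,
      monoid.mult = (\<lambda>X Y. \<Union>u\<in>X. \<Union>v\<in>Y. free_eq A \<iota> `` {u @ v}),
      one = free_eq A \<iota> `` {[]}\<rparr>"

definition normal_closure :: "('g, 'm) monoid_scheme \<Rightarrow> 'g set \<Rightarrow> 'g set" where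
  "normal_closure G S =
     generate G {g \<otimes>\<^bsub>G\<^esub> s \<otimes>\<^bsub>G\<^esub> inv\<^bsub>G\<^esub> g | g s. g \<in> carrier G \<and> s \<in> S}"

definition relator_subgroup :: "'a set \<Rightarrow> ('a \<Rightarrow> 'a) \<Rightarrow> 'a list set \<Rightarrow> 'a list set set" where
  "relator_subgroup A \<iota> R =
     normal_closure (free_group_on A \<iota>) ((\<lambda>r. free_eq A \<iota> `` {r}) ` R)"

definition presented_group :: "'a set \<Rightarrow> ('a \<Rightarrow> 'a) \<Rightarrow> 'a list set \<Rightarrow> 'a list set set monoid" where
  "presented_group A \<iota> R = free_group_on A \<iota> Mod relator_subgroup A \<iota> R"

definition presented_letter :: "'a set \<Rightarrow> ('a \<Rightarrow> 'a) \<Rightarrow> 'a list set \<Rightarrow> 'a \<Rightarrow> 'a list set set" where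
  "presented_letter A \<iota> R a =
     relator_subgroup A \<iota> R #>\<^bsub>free_group_on A \<iota>\<^esub> (free_eq A \<iota> `` {[a]})"

text \<open>
  The isomorphism is the canonical one: it must send each letter to the element of the group
  that the letter represents.
\<close>

definition is_presentation ::
  "('g, 'm) monoid_scheme \<Rightarrow> 'a set \<Rightarrow> ('a \<Rightarrow> 'a) \<Rightarrow> ('a \<Rightarrow> 'g) \<Rightarrow> 'a list set \<Rightarrow> bool" where
  "is_presentation G A \<iota> \<pi> R \<longleftrightarrow> R \<subseteq> lists A \<and>
     (\<exists>\<phi> \<in> iso (presented_group A \<iota> R) G. \<forall>a\<in>A. \<phi> (presented_letter A \<iota> R a) = \<pi> a)"

definition is_finite_presentation ::
  "('g, 'm) monoid_scheme \<Rightarrow> 'a set \<Rightarrow> ('a \<Rightarrow> 'a) \<Rightarrow> ('a \<Rightarrow> 'g) \<Rightarrow> 'a list set \<Rightarrow> bool" where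
  "is_finite_presentation G A \<iota> \<pi> R \<longleftrightarrow> finite A \<and> finite R \<and> is_presentation G A \<iota> \<pi> R"

definition is_normal_form_set ::
  "('g, 'm) monoid_scheme \<Rightarrow> 'a set \<Rightarrow> ('a \<Rightarrow> 'g) \<Rightarrow> 'a list set \<Rightarrow> bool" where
  "is_normal_form_set G A \<pi> N \<longleftrightarrow>
     N \<subseteq> lists A \<and> (\<forall>g \<in> carrier G. \<exists>!w. w \<in> N \<and> word_value G \<pi> w = g)"

definition normal_form ::
  "('g, 'm) monoid_scheme \<Rightarrow> ('a \<Rightarrow> 'g) \<Rightarrow> 'a list set \<Rightarrow> 'g \<Rightarrow> 'a list" where
  "normal_form G \<pi> N g = (THE w. w \<in> N \<and> word_value G \<pi> w = g)"

text \<open>The directed edge labelled \<open>a\<close> from \<open>g\<close> to \<open>g \<otimes> \<pi> a\<close> is the pair \<open>(g, a)\<close>.\<close>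

definition cayley_edges :: "('g, 'm) monoid_scheme \<Rightarrow> 'a set \<Rightarrow> ('g \<times> 'a) set" where
  "cayley_edges G A = carrier G \<times> A"

fun path_edges :: "('g, 'm) monoid_scheme \<Rightarrow> ('a \<Rightarrow> 'g) \<Rightarrow> 'g \<Rightarrow> 'a list \<Rightarrow> ('g \<times> 'a) set" where
  "path_edges G \<pi> g [] = {}"
| "path_edges G \<pi> g (a # w) = insert (g, a) (path_edges G \<pi> (g \<otimes>\<^bsub>G\<^esub> \<pi> a) w)"

definition degenerate_edges ::
  "('g, 'm) monoid_scheme \<Rightarrow> 'a set \<Rightarrow> ('a \<Rightarrow> 'a) \<Rightarrow> ('a \<Rightarrow> 'g) \<Rightarrow> 'a list set \<Rightarrow> ('g \<times> 'a) set" where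
  "degenerate_edges G A \<iota> \<pi> N = {(g, a) \<in> cayley_edges G A.
     normal_form G \<pi> N g @ [a] = normal_form G \<pi> N (g \<otimes>\<^bsub>G\<^esub> \<pi> a) \<or>
     normal_form G \<pi> N g = normal_form G \<pi> N (g \<otimes>\<^bsub>G\<^esub> \<pi> a) @ [\<iota> a]}"

definition recursive_edges ::
  "('g, 'm) monoid_scheme \<Rightarrow> 'a set \<Rightarrow> ('a \<Rightarrow> 'a) \<Rightarrow> ('a \<Rightarrow> 'g) \<Rightarrow> 'a list set \<Rightarrow> ('g \<times> 'a) set" where
  "recursive_edges G A \<iota> \<pi> N = cayley_edges G A - degenerate_edges G A \<iota> \<pi> N"

text \<open>
  The second component \<open>c\<close> of a stacking is a total function, but only its values on recursive
  edges are ever used. A pair \<open>(e', e)\<close> belongs to the order iff \<open>e'\<close> is below \<open>e\<close>.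
\<close>

definition stacking_order ::
  "('g, 'm) monoid_scheme \<Rightarrow> 'a set \<Rightarrow> ('a \<Rightarrow> 'a) \<Rightarrow> ('a \<Rightarrow> 'g) \<Rightarrow> 'a list set \<Rightarrow>
   ('g \<times> 'a \<Rightarrow> 'a list) \<Rightarrow> (('g \<times> 'a) \<times> ('g \<times> 'a)) set" where
  "stacking_order G A \<iota> \<pi> N c =
     {(e', e). e' \<in> recursive_edges G A \<iota> \<pi> N \<and> e \<in> recursive_edges G A \<iota> \<pi> N \<and>
        e' \<in> path_edges G \<pi> (fst e) (c e)}\<^sup>+"

definition is_stacking ::
  "('g, 'm) monoid_scheme \<Rightarrow> 'a set \<Rightarrow> ('a \<Rightarrow> 'a) \<Rightarrow> ('a \<Rightarrow> 'g) \<Rightarrow> 'a list set \<Rightarrow>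
   ('g \<times> 'a \<Rightarrow> 'a list) \<Rightarrow> bool" where
  "is_stacking G A \<iota> \<pi> N c \<longleftrightarrow>
     is_normal_form_set G A \<pi> N \<and>
     normal_form G \<pi> N \<one>\<^bsub>G\<^esub> = [] \<and>
     c ` recursive_edges G A \<iota> \<pi> N \<subseteq> lists A \<and>
     (\<forall>(g, a) \<in> recursive_edges G A \<iota> \<pi> N. word_value G \<pi> (c (g, a)) = \<pi> a) \<and>
     irrefl (stacking_order G A \<iota> \<pi> N c) \<and> trans (stacking_order G A \<iota> \<pi> N c) \<and>
     (\<forall>e \<in> recursive_edges G A \<iota> \<pi> N. finite {e''. (e'', e) \<in> stacking_order G A \<iota> \<pi> N c}) \<and>
     finite (c ` recursive_edges G A \<iota> \<pi> N)"

inductive_set relator_closure :: "('a \<Rightarrow> 'a) \<Rightarrow> 'a list set \<Rightarrow> 'a list set"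
  for \<iota> :: "'a \<Rightarrow> 'a" and R :: "'a list set" where
  base: "w \<in> R \<Longrightarrow> w \<in> relator_closure \<iota> R"
| inversion: "w \<in> relator_closure \<iota> R \<Longrightarrow> inverse_word \<iota> w \<in> relator_closure \<iota> R"
| cyclic_conjugation: "u @ v \<in> relator_closure \<iota> R \<Longrightarrow> v @ u \<in> relator_closure \<iota> R"
| free_reduction:
    "w \<in> relator_closure \<iota> R \<Longrightarrow> free_cancellation \<iota> w w' \<Longrightarrow> w' \<in> relator_closure \<iota> R"

definition stacking_relators ::
  "('g, 'm) monoid_scheme \<Rightarrow> 'a set \<Rightarrow> ('a \<Rightarrow> 'a) \<Rightarrow> ('a \<Rightarrow> 'g) \<Rightarrow> 'a list set \<Rightarrow>
   ('g \<times> 'a \<Rightarrow> 'a list) \<Rightarrow> 'a list set" where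
  "stacking_relators G A \<iota> \<pi> N c =
     relator_closure \<iota> {c (g, a) @ [\<iota> a] | g a. (g, a) \<in> recursive_edges G A \<iota> \<pi> N} - {[]}"

end

theory Submission
  imports Defs
begin

text \<open>
  The stacking order is well-founded and a degenerate edge has no predecessors, so a property of
  edges that passes from the edges of the path labelled \<open>c e\<close> to \<open>e\<close>, and holds for degenerate
  edges, holds for all edges. Applied to ``\<open>y_g a\<close> and \<open>y_ga\<close> are equal modulo the relators'' this
  shows that every word equals its normal form in the presented group. Applied to ``all prefixes of
  \<open>y_g\<close> are normal forms iff all prefixes of \<open>y_ga\<close> are'' it gives prefix closure, because the
  Cayley graph is connected and \<open>y_\<epsilon>\<close> is empty.
\<close>

declare in_listsD [rule del] in_listsI [rule del]

section \<open>The free group on an alphabet with inversion\<close>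

locale inverse_alphabet =
  fixes A :: "'a set" and \<iota> :: "'a \<Rightarrow> 'a"
  assumes inv_closed: "a \<in> A \<Longrightarrow> \<iota> a \<in> A"
    and inv_involutive: "a \<in> A \<Longrightarrow> \<iota> (\<iota> a) = a"
begin

abbreviation word_class :: "'a list \<Rightarrow> 'a list set" where
  "word_class w \<equiv> free_eq A \<iota> `` {w}"

abbreviation free_group :: "'a list set monoid" where
  "free_group \<equiv> free_group_on A \<iota>"

lemma equiv_free_eq: "equiv (lists A) (free_eq A \<iota>)"
proof (rule equivI)
  show "free_eq A \<iota> \<subseteq> lists A \<times> lists A" by (auto simp: free_eq_def)
  show "refl_on (lists A) (free_eq A \<iota>)" by (auto simp: free_eq_def refl_on_def)
  show "sym (free_eq A \<iota>)" by (auto simp: free_eq_def sym_def intro: equivclp_sym)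
  show "trans (free_eq A \<iota>)" by (auto simp: free_eq_def trans_def intro: equivclp_trans)
qed

text \<open>Induction along the zigzag of cancellations joining \<open>u\<close> to
  \<open>v\<close>. The cancelled letter lies in \<open>A\<close> because both words of each step
  do. With classes as values of \<open>f\<close> this makes the product well defined; with group
  elements as values it does the same for evaluation.\<close>

lemma free_eq_cong_fun:
  assumes "(u, v) \<in> free_eq A \<iota>"
    and step: "\<And>x y a. x \<in> lists A \<Longrightarrow> y \<in> lists A \<Longrightarrow> a \<in> A \<Longrightarrow> f (x @ [a, \<iota> a] @ y) = f (x @ y)"
  shows "f u = f v"
proof -
  have "equivclp (\<lambda>x y. x \<in> lists A \<and> y \<in> lists A \<and> free_cancellation \<iota> x y) u v"
    using assms by (simp add: free_eq_def)
  then show ?thesis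
  proof (induction rule: equivclp_induct)
    case (step y z)
    have "f x = f y" if "x \<in> lists A" "free_cancellation \<iota> x y" for x y
      using that(2,1)
    proof cases
      case (1 p a q)
      with that(1) assms(2)[of p q a] show ?thesis by simp
    qed
    with step show ?case by metis
  qed simp
qed

lemma word_class_eq_iff:
  "u \<in> lists A \<Longrightarrow> v \<in> lists A \<Longrightarrow> word_class u = word_class v \<longleftrightarrow> (u, v) \<in> free_eq A \<iota>"
  by (rule eq_equiv_class_iff[OF equiv_free_eq])

lemma word_class_cancel:
  assumes "x \<in> lists A" "y \<in> lists A" "a \<in> A"
  shows "word_class (x @ [a, \<iota> a] @ y) = word_class (x @ y)"
proof -
  have "(x @ [a, \<iota> a] @ y, x @ y) \<in> free_eq A \<iota>"
    using assms free_cancellation.intros[of \<iota> x a y]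
    by (simp add: free_eq_def inv_closed r_into_equivclp)
  then show ?thesis by (rule equiv_class_eq[OF equiv_free_eq])
qed

lemma word_class_append_cong:
  assumes "(u, u') \<in> free_eq A \<iota>" "(v, v') \<in> free_eq A \<iota>"
  shows "word_class (u @ v) = word_class (u' @ v')"
proof -
  have lists: "u' \<in> lists A" "v \<in> lists A" using assms by (auto simp: free_eq_def)
  have "word_class (u @ v) = word_class (u' @ v)"
  proof (rule free_eq_cong_fun[OF assms(1)])
    show "word_class ((x @ [a, \<iota> a] @ y) @ v) = word_class ((x @ y) @ v)"
      if "x \<in> lists A" "y \<in> lists A" "a \<in> A" for x y a
      using word_class_cancel[of x "y @ v" a] that lists by simp
  qed
  also have "\<dots> = word_class (u' @ v')"
  proof (rule free_eq_cong_fun[OF assms(2)])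
    show "word_class (u' @ x @ [a, \<iota> a] @ y) = word_class (u' @ x @ y)"
      if "x \<in> lists A" "y \<in> lists A" "a \<in> A" for x y a
      using word_class_cancel[of "u' @ x" y a] that lists by simp
  qed
  finally show ?thesis .
qed

lemma word_class_in_carrier: "w \<in> lists A \<Longrightarrow> word_class w \<in> carrier free_group"
  by (simp add: free_group_on_def quotientI)

lemma carrier_free_groupE:
  assumes "X \<in> carrier free_group"
  obtains w where "w \<in> lists A" "X = word_class w"
  using assms by (auto simp: free_group_on_def elim: quotientE)

text \<open>The product of the free group is a union over all pairs of representatives. Since
  concatenation respects the congruence, all classes in this union coincide and one class
  remains.\<close>

lemma word_class_mult:
  assumes "u \<in> lists A" "v \<in> lists A"
  shows "word_class u \<otimes>\<^bsub>free_group\<^esub> word_class v = word_class (u @ v)"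
proof -
  have "congruent2 (free_eq A \<iota>) (free_eq A \<iota>) (\<lambda>u v. word_class (u @ v))"
    by (auto intro!: congruent2I' word_class_append_cong)
  then show ?thesis
    using UN_equiv_class2[OF equiv_free_eq equiv_free_eq _ assms] by (simp add: free_group_on_def)
qed

lemma one_free_group: "\<one>\<^bsub>free_group\<^esub> = word_class []"
  by (simp add: free_group_on_def)

lemma inverse_word_in_lists: "w \<in> lists A \<Longrightarrow> inverse_word \<iota> w \<in> lists A"
  by (auto simp: inverse_word_def inv_closed in_lists_conv_set)

lemma word_class_inverse_append:
  "w \<in> lists A \<Longrightarrow> word_class (inverse_word \<iota> w @ w) = word_class []"
proof (induction w)
  case (Cons a w)
  \<comment> \<open>The innermost pair is \<open>\<iota> a\<close> followed by \<open>a\<close>;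
    writing \<open>a\<close> as \<open>\<iota> (\<iota> a)\<close> gives it the shape of a
    cancellation.\<close>
  then have "word_class (inverse_word \<iota> w @ [\<iota> a, \<iota> (\<iota> a)] @ w) = word_class (inverse_word \<iota> w @ w)"
    by (intro word_class_cancel) (auto simp: inv_closed inverse_word_in_lists)
  with Cons show ?case by (simp add: inverse_word_def inv_involutive)
qed (simp add: inverse_word_def)

lemma group_free_group: "group free_group"
proof (rule groupI)
  fix X Y assume "X \<in> carrier free_group" "Y \<in> carrier free_group"
  then show "X \<otimes>\<^bsub>free_group\<^esub> Y \<in> carrier free_group"
    by (auto elim!: carrier_free_groupE simp: word_class_mult intro!: word_class_in_carrier)
next
  show "\<one>\<^bsub>free_group\<^esub> \<in> carrier free_group"
    by (simp add: one_free_group word_class_in_carrier)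
next
  fix X Y Z
  assume "X \<in> carrier free_group" "Y \<in> carrier free_group" "Z \<in> carrier free_group"
  then obtain u v w where "u \<in> lists A" "X = word_class u" "v \<in> lists A" "Y = word_class v"
    "w \<in> lists A" "Z = word_class w"
    by (elim carrier_free_groupE)
  then show "X \<otimes>\<^bsub>free_group\<^esub> Y \<otimes>\<^bsub>free_group\<^esub> Z = X \<otimes>\<^bsub>free_group\<^esub> (Y \<otimes>\<^bsub>free_group\<^esub> Z)"
    by (simp add: word_class_mult)
next
  fix X assume "X \<in> carrier free_group"
  then obtain w where w: "w \<in> lists A" "X = word_class w" by (rule carrier_free_groupE)
  then show "\<one>\<^bsub>free_group\<^esub> \<otimes>\<^bsub>free_group\<^esub> X = X"
    using word_class_mult[of "[]" w] by (simp add: one_free_group)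
  show "\<exists>Y\<in>carrier free_group. Y \<otimes>\<^bsub>free_group\<^esub> X = \<one>\<^bsub>free_group\<^esub>"
  proof
    show "word_class (inverse_word \<iota> w) \<otimes>\<^bsub>free_group\<^esub> X = \<one>\<^bsub>free_group\<^esub>"
      using w by (simp add: one_free_group word_class_mult word_class_inverse_append
          inverse_word_in_lists)
    show "word_class (inverse_word \<iota> w) \<in> carrier free_group"
      using w by (intro word_class_in_carrier inverse_word_in_lists)
  qed
qed

end

section \<open>Normal closures in a group\<close>

lemma (in group) normal_closure_normal:
  assumes "S \<subseteq> carrier G"
  shows "normal_closure G S \<lhd> G"
  unfolding normal_closure_def
proof (rule normal_generateI)
  show "{g \<otimes> s \<otimes> inv g |g s. g \<in> carrier G \<and> s \<in> S} \<subseteq> carrier G" using assms by auto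
next
  fix h k
  assume "h \<in> {g \<otimes> s \<otimes> inv g |g s. g \<in> carrier G \<and> s \<in> S}" and k: "k \<in> carrier G"
  then obtain g s where gs: "h = g \<otimes> s \<otimes> inv g" "g \<in> carrier G" "s \<in> S" by blast
  then have "s \<in> carrier G" using assms by blast
  \<comment> \<open>The generators are permuted by conjugation: conjugating by \<open>k\<close>
    turns the conjugator \<open>g\<close> into \<open>k \<otimes> g\<close>, so the generated
    subgroup is normal.\<close>
  then have "k \<otimes> h \<otimes> inv k = (k \<otimes> g) \<otimes> s \<otimes> inv (k \<otimes> g)"
    using gs k by (simp add: inv_mult_group m_assoc)
  with gs k show "k \<otimes> h \<otimes> inv k \<in> {g \<otimes> s \<otimes> inv g |g s. g \<in> carrier G \<and> s \<in> S}"
    by blast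
qed

lemma (in group) subset_normal_closure:
  assumes "S \<subseteq> carrier G"
  shows "S \<subseteq> normal_closure G S"
proof
  fix s assume "s \<in> S"
  with assms have "s = \<one> \<otimes> s \<otimes> inv \<one>" by auto
  with \<open>s \<in> S\<close> show "s \<in> normal_closure G S"
    unfolding normal_closure_def by (intro generate.incl) blast
qed

lemma (in group) normal_closure_subset:
  assumes "K \<lhd> G" "S \<subseteq> K"
  shows "normal_closure G S \<subseteq> K"
  unfolding normal_closure_def
  using assms normal.inv_op_closed2[OF assms(1)]
  by (intro generate_subgroup_incl normal_imp_subgroup) auto

section \<open>Words in a group\<close>

context symmetric_generating_set
begin

sublocale inverse_alphabet A \<iota>
  by unfold_locales (auto intro: letter_inverse_closed letter_inverse_involutive)

abbreviation val :: "'a list \<Rightarrow> 'g" where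
  "val \<equiv> word_value G \<pi>"

lemma val_Nil [simp]: "val [] = \<one>"
  by (simp add: word_value_def)

lemma val_Cons [simp]: "val (a # w) = \<pi> a \<otimes> val w"
  by (simp add: word_value_def)

lemma val_closed [simp]: "w \<in> lists A \<Longrightarrow> val w \<in> carrier G"
  by (induction w) (auto simp: letter_value_closed)

lemma val_append: "u \<in> lists A \<Longrightarrow> v \<in> lists A \<Longrightarrow> val (u @ v) = val u \<otimes> val v"
  by (induction u) (auto simp: letter_value_closed m_assoc)

lemma val_inverse_word: "w \<in> lists A \<Longrightarrow> val (inverse_word \<iota> w) = inv (val w)"
proof (induction w)
  case (Cons a w)
  then have "val (inverse_word \<iota> w @ [\<iota> a]) = inv (val w) \<otimes> inv (\<pi> a)"
    by (subst val_append)
      (auto simp: inverse_word_in_lists inv_closed letter_value_closed letter_value_inverse)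
  with Cons show ?case
    by (simp add: inverse_word_def inv_mult_group letter_value_closed)
qed (simp add: inverse_word_def)

lemma val_cancel:
  assumes "x \<in> lists A" "y \<in> lists A" "a \<in> A"
  shows "val (x @ [a, \<iota> a] @ y) = val (x @ y)"
proof -
  have "val ([a, \<iota> a] @ y) = val y"
    using assms by (simp add: letter_value_closed letter_value_inverse m_assoc[symmetric])
  moreover have "[a, \<iota> a] @ y \<in> lists A" using assms inv_closed by auto
  ultimately show ?thesis using assms by (simp only: val_append)
qed

lemma path_edges_subset:
  "g \<in> carrier G \<Longrightarrow> w \<in> lists A \<Longrightarrow> path_edges G \<pi> g w \<subseteq> cayley_edges G A"
  by (induction w arbitrary: g) (auto simp: cayley_edges_def letter_value_closed)

section \<open>Closure of a relator set: finiteness and soundness\<close>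

lemma relator_closure_in_lists:
  assumes "w \<in> relator_closure \<iota> R" "R \<subseteq> lists A"
  shows "w \<in> lists A"
  using assms
  by (induction rule: relator_closure.induct)
    (auto simp: inverse_word_in_lists free_cancellation.simps)

text \<open>Inversion and cyclic conjugation keep the length and a cancellation lowers it by two.
  Over a finite alphabet this bound makes the closure finite.\<close>

lemma relator_closure_length:
  assumes "w \<in> relator_closure \<iota> R" "\<And>r. r \<in> R \<Longrightarrow> length r \<le> n"
  shows "length w \<le> n"
  using assms
  by (induction rule: relator_closure.induct)
    (auto simp: inverse_word_def free_cancellation.simps)

lemma finite_relator_closure:
  assumes "finite A" "finite R" "R \<subseteq> lists A"
  shows "finite (relator_closure \<iota> R)"
proof (rule finite_subset)
  \<comment> \<open>For empty \<open>R\<close> the value of \<open>Max\<close> is unspecified, but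
    the length bound on relators is then vacuous and the inclusion still holds.\<close>
  show "relator_closure \<iota> R \<subseteq> {w. set w \<subseteq> A \<and> length w \<le> Max (length ` R)}"
    using relator_closure_in_lists[OF _ assms(3)] relator_closure_length[of _ R "Max (length ` R)"]
      assms(2) by (auto simp: in_lists_conv_set)
  show "finite {w. set w \<subseteq> A \<and> length w \<le> Max (length ` R)}"
    by (rule finite_lists_length_le[OF assms(1)])
qed

lemma val_relator_closure:
  assumes "w \<in> relator_closure \<iota> R" "R \<subseteq> lists A" "\<And>r. r \<in> R \<Longrightarrow> val r = \<one>"
  shows "val w = \<one>"
  using assms
proof (induction rule: relator_closure.induct)
  case (inversion w)
  then show ?case using relator_closure_in_lists[OF inversion(1)] by (simp add: val_inverse_word)
next
  case (cyclic_conjugation u v)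
  then have "u @ v \<in> lists A" using relator_closure_in_lists by blast
  then have uv: "u \<in> lists A" "v \<in> lists A" by auto
  with cyclic_conjugation have "val u \<otimes> val v = \<one>" by (simp add: val_append)
  then have "val v \<otimes> val u = \<one>" using uv inv_comm by simp
  with uv show ?case by (simp add: val_append)
next
  case (free_reduction w w')
  have "w \<in> lists A" using free_reduction relator_closure_in_lists by blast
  with free_reduction show ?case
    using val_cancel by (auto simp: free_cancellation.simps simp del: val_Cons append.simps)
qed auto

section \<open>Evaluation of the free group in \<open>G\<close> and a criterion for
  presentations\<close>

definition free_eval :: "'a list set \<Rightarrow> 'g" where
  "free_eval X = the_elem (val ` X)"

text \<open>Inserting or deleting \<open>a (\<iota> a)\<close> does not change \<open>val\<close>,
  so the image of a class under \<open>val\<close> is a singleton and \<open>the_elem\<close>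
  returns its member.\<close>

lemma free_eval_word_class:
  assumes "w \<in> lists A"
  shows "free_eval (word_class w) = val w"
proof -
  have "val u = val w" if "u \<in> word_class w" for u
    using that free_eq_cong_fun[where f = val, OF _ val_cancel] by (metis Image_singleton_iff)
  moreover have "word_class w \<noteq> {}"
    using equiv_class_self[OF equiv_free_eq assms] by (metis empty_iff)
  ultimately show ?thesis unfolding free_eval_def by (intro the_elem_image_unique)
qed

lemma free_eval_hom: "free_eval \<in> hom free_group G"
proof (rule homI)
  fix X assume "X \<in> carrier free_group"
  then show "free_eval X \<in> carrier G"
    by (rule carrier_free_groupE) (simp add: free_eval_word_class)
next
  fix X Y assume "X \<in> carrier free_group" "Y \<in> carrier free_group"
  then obtain u v where "u \<in> lists A" "X = word_class u" "v \<in> lists A" "Y = word_class v"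
    by (elim carrier_free_groupE)
  then show "free_eval (X \<otimes>\<^bsub>free_group\<^esub> Y) = free_eval X \<otimes> free_eval Y"
    by (simp add: free_eval_word_class word_class_mult val_append)
qed

text \<open>First isomorphism theorem for \<open>free_eval\<close>. That relators have value one
  puts their normal closure inside the kernel; \<open>complete\<close> gives the reverse
  inclusion.\<close>

lemma is_presentationI:
  assumes surj: "\<And>g. g \<in> carrier G \<Longrightarrow> \<exists>w\<in>lists A. val w = g"
    and R: "R \<subseteq> lists A" "\<And>r. r \<in> R \<Longrightarrow> val r = \<one>"
    and complete: "\<And>w. w \<in> lists A \<Longrightarrow> val w = \<one> \<Longrightarrow> word_class w \<in> relator_subgroup A \<iota> R"
  shows "is_presentation G A \<iota> \<pi> R"
proof -
  interpret F: group free_group by (rule group_free_group)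
  interpret ev: group_hom free_group G free_eval
    by unfold_locales (rule free_eval_hom)
  have kernel: "kernel free_group G free_eval = relator_subgroup A \<iota> R"
  proof
    show "relator_subgroup A \<iota> R \<subseteq> kernel free_group G free_eval"
      unfolding relator_subgroup_def
    proof (intro F.normal_closure_subset ev.normal_kernel image_subsetI)
      fix r assume "r \<in> R"
      with R have "r \<in> lists A" "val r = \<one>" by auto
      then show "word_class r \<in> kernel free_group G free_eval"
        by (simp add: kernel_def free_eval_word_class word_class_in_carrier)
    qed
    show "kernel free_group G free_eval \<subseteq> relator_subgroup A \<iota> R"
    proof
      fix X assume "X \<in> kernel free_group G free_eval"
      then have X: "X \<in> carrier free_group" "free_eval X = \<one>" by (simp_all add: kernel_def)
      then obtain w where "w \<in> lists A" "X = word_class w" by (elim carrier_free_groupE)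
      with X(2) complete show "X \<in> relator_subgroup A \<iota> R" by (simp add: free_eval_word_class)
    qed
  qed
  have "g \<in> free_eval ` carrier free_group" if g: "g \<in> carrier G" for g
  proof -
    obtain w where "w \<in> lists A" "val w = g" using surj[OF g] by blast
    then show ?thesis
      by (intro image_eqI[of _ _ "word_class w"])
        (simp_all add: free_eval_word_class word_class_in_carrier)
  qed
  then have "free_eval ` carrier free_group = carrier G" by auto
  then have iso: "(\<lambda>X. the_elem (free_eval ` X)) \<in> iso (presented_group A \<iota> R) G"
    using ev.FactGroup_iso_set by (simp add: presented_group_def kernel)
  \<comment> \<open>The induced isomorphism sends a coset to the common value of
    \<open>free_eval\<close> on it. Members of the coset of a letter differ from the class of that
    letter by a kernel element, so this value is \<open>\<pi> a\<close>.\<close>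
  have "the_elem (free_eval ` presented_letter A \<iota> R a) = \<pi> a" if a: "a \<in> A" for a
  proof -
    have cl: "word_class [a] \<in> carrier free_group"
      using a by (intro word_class_in_carrier) auto
    have ev_a: "free_eval (word_class [a]) = \<pi> a"
      using a by (simp add: free_eval_word_class letter_value_closed)
    have eval_coset: "free_eval x = \<pi> a" if x: "x \<in> presented_letter A \<iota> R a" for x
    proof -
      obtain k where "k \<in> kernel free_group G free_eval"
        and "x = k \<otimes>\<^bsub>free_group\<^esub> word_class [a]"
        using x unfolding presented_letter_def kernel[symmetric] r_coset_def by (elim UN_E singletonE)
      moreover from this(1) have "k \<in> carrier free_group" "free_eval k = \<one>"
        by (simp_all add: kernel_def)
      ultimately show ?thesis using cl ev_a a by (simp add: letter_value_closed)
    qed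
    have "word_class [a] \<in> presented_letter A \<iota> R a"
      unfolding presented_letter_def kernel[symmetric]
      by (rule F.rcos_self[OF cl ev.subgroup_kernel])
    then have "presented_letter A \<iota> R a \<noteq> {}" by (metis empty_iff)
    then show ?thesis by (rule the_elem_image_unique) (rule eval_coset)
  qed
  with iso R(1) show ?thesis unfolding is_presentation_def by (intro conjI bexI[OF _ iso] ballI)
qed

end

section \<open>Stackings\<close>

locale stacking = symmetric_generating_set G A \<iota> \<pi>
  for G :: "('g, 'm) monoid_scheme" (structure)
    and A :: "'a set" and \<iota> :: "'a \<Rightarrow> 'a" and \<pi> :: "'a \<Rightarrow> 'g" +
  fixes N :: "'a list set" and c :: "'g \<times> 'a \<Rightarrow> 'a list"
  assumes stacking: "is_stacking G A \<iota> \<pi> N c"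
begin

abbreviation nf where "nf \<equiv> normal_form G \<pi> N"

abbreviation recursive where "recursive \<equiv> recursive_edges G A \<iota> \<pi> N"

lemma nf_in_N: "g \<in> carrier G \<Longrightarrow> nf g \<in> N"
  and val_nf: "g \<in> carrier G \<Longrightarrow> val (nf g) = g"
proof -
  assume "g \<in> carrier G"
  then have "\<exists>!w. w \<in> N \<and> val w = g"
    using stacking by (simp add: is_stacking_def is_normal_form_set_def)
  from theI'[OF this] show "nf g \<in> N" "val (nf g) = g" by (simp_all add: normal_form_def)
qed

lemma N_in_lists: "w \<in> N \<Longrightarrow> w \<in> lists A"
  using stacking by (auto simp: is_stacking_def is_normal_form_set_def)

lemma nf_val: "w \<in> N \<Longrightarrow> nf (val w) = w"
  using stacking nf_in_N val_nf N_in_lists val_closed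
  unfolding is_stacking_def is_normal_form_set_def by metis

lemma nf_one: "nf \<one> = []"
  using stacking by (simp add: is_stacking_def)

lemma nf_in_lists: "g \<in> carrier G \<Longrightarrow> nf g \<in> lists A"
  using nf_in_N N_in_lists by blast

lemma recursive_edgeD:
  assumes "(g, a) \<in> recursive"
  shows "g \<in> carrier G" "a \<in> A" "c (g, a) \<in> lists A" "val (c (g, a)) = \<pi> a"
  using assms stacking
  by (auto simp: recursive_edges_def cayley_edges_def is_stacking_def)

section \<open>Well-founded induction over the edges of the Cayley graph\<close>

lemma wf_stacking_order: "wf (stacking_order G A \<iota> \<pi> N c)"
proof -
  let ?r = "stacking_order G A \<iota> \<pi> N c"
  have "trans ?r" "irrefl ?r" using stacking by (auto simp: is_stacking_def)
  \<comment> \<open>Finiteness of the set of smaller edges is assumed only for recursive edges; the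
    upper member of a related pair is always one.\<close>
  have "e \<in> recursive" if "(e', e) \<in> ?r" for e' e
    using that unfolding stacking_order_def by (induction rule: trancl_induct) auto
  then have fin: "finite {e''. (e'', e) \<in> ?r}" if "(e', e) \<in> ?r" for e' e
    using that stacking by (auto simp: is_stacking_def)
  \<comment> \<open>The number of edges below serves as a measure. By transitivity everything below
    \<open>e'\<close> is below \<open>e\<close>, and by irreflexivity \<open>e'\<close> itself is
    below \<open>e\<close> but not below \<open>e'\<close>.\<close>
  have "card {e''. (e'', e') \<in> ?r} < card {e''. (e'', e) \<in> ?r}" if "(e', e) \<in> ?r" for e' e
  proof (rule psubset_card_mono)
    show "{e''. (e'', e') \<in> ?r} \<subset> {e''. (e'', e) \<in> ?r}"
      using that transD[OF \<open>trans ?r\<close>] irreflD[OF \<open>irrefl ?r\<close>] by blast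
  qed (rule fin[OF that])
  then have "?r \<subseteq> measure (\<lambda>e. card {e''. (e'', e) \<in> ?r})" by auto
  then show ?thesis by (rule wf_subset[OF wf_measure])
qed

text \<open>The order compares only recursive edges, yet the hypothesis of the case
  \<open>recursive\<close> covers every edge of the path: the recursive ones are smaller, and the
  degenerate ones satisfy \<open>P\<close> outright by \<open>extend\<close> or
  \<open>shorten\<close>.\<close>

lemma edge_induct [consumes 2, case_names extend shorten recursive]:
  assumes "g \<in> carrier G" "a \<in> A"
    and extend: "\<And>g a. g \<in> carrier G \<Longrightarrow> a \<in> A \<Longrightarrow> nf (g \<otimes> \<pi> a) = nf g @ [a] \<Longrightarrow> P g a"
    and shorten: "\<And>g a. g \<in> carrier G \<Longrightarrow> a \<in> A \<Longrightarrow> nf g = nf (g \<otimes> \<pi> a) @ [\<iota> a] \<Longrightarrow> P g a"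
    and recursive: "\<And>g a. (g, a) \<in> recursive \<Longrightarrow>
      (\<And>h b. (h, b) \<in> path_edges G \<pi> g (c (g, a)) \<Longrightarrow> P h b) \<Longrightarrow> P g a"
  shows "P g a"
proof -
  have "e \<in> cayley_edges G A \<longrightarrow> P (fst e) (snd e)" for e
    using wf_stacking_order
  proof (induction e rule: wf_induct_rule)
    case (less e)
    obtain g a where e: "e = (g, a)" by fastforce
    have "P g a" if ga: "(g, a) \<in> cayley_edges G A"
    proof (cases "(g, a) \<in> recursive")
      case True
      have "P h b" if "(h, b) \<in> path_edges G \<pi> g (c (g, a))" for h b
      proof -
        have hb: "(h, b) \<in> cayley_edges G A"
          using that path_edges_subset recursive_edgeD[OF True] by blast
        show ?thesis
        proof (cases "(h, b) \<in> recursive")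
          case hb_rec: True
          then have "((h, b), e) \<in> stacking_order G A \<iota> \<pi> N c"
            unfolding stacking_order_def e using that True by (intro r_into_trancl) auto
          with less hb show ?thesis by fastforce
        next
          case False
          with hb extend shorten show ?thesis
            by (fastforce simp: recursive_edges_def degenerate_edges_def cayley_edges_def)
        qed
      qed
      with recursive True show ?thesis by blast
    next
      case False
      with ga extend shorten show ?thesis
        by (fastforce simp: recursive_edges_def degenerate_edges_def cayley_edges_def)
    qed
    then show ?case by (simp add: e)
  qed
  from this[of "(g, a)"] assms(1,2) show ?thesis by (simp add: cayley_edges_def)
qed

section \<open>Transport along paths and prefix closure of the normal forms\<close>

lemma invariant_along_path:
  assumes "g \<in> carrier G" "w \<in> lists A"
    and "\<And>h b. (h, b) \<in> path_edges G \<pi> g w \<Longrightarrow> f h = f (h \<otimes> \<pi> b)"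
  shows "f g = f (g \<otimes> val w)"
  using assms
proof (induction w arbitrary: g)
  case (Cons a w)
  have "f (g \<otimes> \<pi> a) = f (g \<otimes> \<pi> a \<otimes> val w)"
    using Cons.prems by (intro Cons.IH) (auto simp: letter_value_closed)
  moreover have "f g = f (g \<otimes> \<pi> a)" using Cons.prems(3) by simp
  ultimately show ?case using Cons.prems(1,2) by (auto simp: letter_value_closed m_assoc)
qed simp

lemma N_prefix_closed:
  assumes "w \<in> N" "prefix u w"
  shows "u \<in> N"
proof -
  \<comment> \<open>An equality of truth values across each edge lets \<open>good\<close> be
    transported as an invariant, both along the paths labelled by \<open>c\<close> and along a path
    from the identity.\<close>
  define good where "good g \<longleftrightarrow> (\<forall>u. prefix u (nf g) \<longrightarrow> u \<in> N)" for g
  have edge: "good g = good (g \<otimes> \<pi> a)" if "g \<in> carrier G" "a \<in> A" for g a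
    using that
  proof (induction rule: edge_induct)
    \<comment> \<open>Across a degenerate edge one normal form is the other with one letter
      appended. Their prefixes differ only by the longer word, which is itself in
      \<open>N\<close>.\<close>
    case (extend g a)
    then show ?case
      using nf_in_N[of "g \<otimes> \<pi> a"] by (auto simp: good_def letter_value_closed)
  next
    case (shorten g a)
    then show ?case using nf_in_N[of g] by (auto simp: good_def)
  next
    case (recursive g a)
    then show ?case
      using invariant_along_path[of g "c (g, a)" good] recursive_edgeD[OF recursive(1)] by simp
  qed
  have wl: "w \<in> lists A" using assms N_in_lists by blast
  \<comment> \<open>The path labelled \<open>w\<close> runs from the identity, whose normal form is
    empty, to the element whose normal form is \<open>w\<close>.\<close>
  have "good \<one> = good (\<one> \<otimes> val w)"
    using edge path_edges_subset[OF one_closed wl] wl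
    by (intro invariant_along_path) (auto simp: cayley_edges_def)
  moreover have "good \<one>" using nf_in_N[OF one_closed] by (simp add: good_def nf_one)
  ultimately show ?thesis using assms wl by (simp add: good_def nf_val)
qed

text \<open>Stated for any multiplicative map \<open>q\<close> from words to a group that kills the
  pairs \<open>a (\<iota> a)\<close> and the relators before closure. The instance used below sends
  a word to its coset in the presented group.\<close>

lemma word_equals_nf:
  fixes H (structure) and q
  assumes "group H"
    and closed: "\<And>u. u \<in> lists A \<Longrightarrow> q u \<in> carrier H"
    and append: "\<And>u v. u \<in> lists A \<Longrightarrow> v \<in> lists A \<Longrightarrow> q (u @ v) = q u \<otimes>\<^bsub>H\<^esub> q v"
    and cancel: "\<And>a. a \<in> A \<Longrightarrow> q [a, \<iota> a] = \<one>\<^bsub>H\<^esub>"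
    and relator: "\<And>g a. (g, a) \<in> recursive \<Longrightarrow> q (c (g, a) @ [\<iota> a]) = \<one>\<^bsub>H\<^esub>"
    and w: "w \<in> lists A"
  shows "q w = q (nf (val w))"
proof -
  interpret H: group H by fact
  \<comment> \<open>The value \<open>q []\<close> is idempotent in a group.\<close>
  have Nil: "q [] = \<one>\<^bsub>H\<^esub>"
    using append[of "[]" "[]"] closed[of "[]"] by simp
  have letters: "q [a] \<otimes>\<^bsub>H\<^esub> q [\<iota> a] = \<one>\<^bsub>H\<^esub>" if "a \<in> A" for a
    using append[of "[a]" "[\<iota> a]"] cancel[OF that] that inv_closed by simp
  have path: "q (nf g) \<otimes>\<^bsub>H\<^esub> q w = q (nf (g \<otimes>\<^bsub>G\<^esub> val w))"
    if "g \<in> carrier G" "w \<in> lists A"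
      and "\<And>h b. (h, b) \<in> path_edges G \<pi> g w \<Longrightarrow> q (nf h) \<otimes>\<^bsub>H\<^esub> q [b] = q (nf (h \<otimes>\<^bsub>G\<^esub> \<pi> b))"
    for g w
    using that
  proof (induction w arbitrary: g)
    case Nil
    then show ?case using \<open>q [] = \<one>\<^bsub>H\<^esub>\<close> closed nf_in_lists by simp
  next
    case (Cons a w)
    then have a: "a \<in> A" "w \<in> lists A" "[a] \<in> lists A" by auto
    have "q (nf g) \<otimes>\<^bsub>H\<^esub> q (a # w) = q (nf g) \<otimes>\<^bsub>H\<^esub> q [a] \<otimes>\<^bsub>H\<^esub> q w"
      using append[of "[a]" w] a Cons.prems(1) closed nf_in_lists by (simp add: H.m_assoc)
    also have "\<dots> = q (nf (g \<otimes>\<^bsub>G\<^esub> \<pi> a)) \<otimes>\<^bsub>H\<^esub> q w" using Cons.prems(3) by simp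
    also have "\<dots> = q (nf (g \<otimes>\<^bsub>G\<^esub> \<pi> a \<otimes>\<^bsub>G\<^esub> val w))"
      using Cons.prems a by (intro Cons.IH) (auto simp: letter_value_closed)
    finally show ?case using a Cons.prems(1) by (simp add: letter_value_closed m_assoc)
  qed
  have edge: "q (nf g) \<otimes>\<^bsub>H\<^esub> q [a] = q (nf (g \<otimes>\<^bsub>G\<^esub> \<pi> a))" if "g \<in> carrier G" "a \<in> A" for g a
    using that
  proof (induction rule: edge_induct)
    case (extend g a)
    then show ?case using append[of "nf g" "[a]"] nf_in_lists by simp
  next
    case (shorten g a)
    let ?y = "nf (g \<otimes>\<^bsub>G\<^esub> \<pi> a)"
    have y: "?y \<in> lists A" using shorten by (simp add: nf_in_lists letter_value_closed)
    have "q (nf g) \<otimes>\<^bsub>H\<^esub> q [a] = q ?y \<otimes>\<^bsub>H\<^esub> (q [\<iota> a] \<otimes>\<^bsub>H\<^esub> q [a])"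
      using shorten y append[of ?y "[\<iota> a]"] by (simp add: closed inv_closed H.m_assoc)
    also have "q [\<iota> a] \<otimes>\<^bsub>H\<^esub> q [a] = \<one>\<^bsub>H\<^esub>"
      using letters[of "\<iota> a"] shorten by (simp add: inv_closed inv_involutive)
    finally show ?case using closed[OF y] by simp
  next
    case (recursive g a)
    note rec = recursive_edgeD[OF recursive(1)]
    \<comment> \<open>Both sides are trivial, the left one by the relator and the right one by free
      cancellation; removing \<open>q [\<iota> a]\<close> on the right identifies
      \<open>c (g, a)\<close> with \<open>a\<close> in \<open>H\<close>.\<close>
    have "q (c (g, a)) \<otimes>\<^bsub>H\<^esub> q [\<iota> a] = q [a] \<otimes>\<^bsub>H\<^esub> q [\<iota> a]"
      using append[of "c (g, a)" "[\<iota> a]"] relator[OF recursive(1)] letters rec inv_closed by simp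
    then have "q (c (g, a)) = q [a]"
      using rec by (subst (asm) H.right_cancel) (auto intro!: closed simp: inv_closed)
    \<comment> \<open>The word \<open>c (g, a)\<close> has value \<open>\<pi> a\<close>, so its path
      from \<open>g\<close> ends at the terminal vertex of the edge.\<close>
    with path[OF rec(1,3) recursive(2)] rec(4) show ?case by simp
  qed
  have "q (nf \<one>\<^bsub>G\<^esub>) \<otimes>\<^bsub>H\<^esub> q w = q (nf (\<one>\<^bsub>G\<^esub> \<otimes>\<^bsub>G\<^esub> val w))"
    using edge path_edges_subset[OF one_closed w] w
    by (intro path) (auto simp: cayley_edges_def)
  then show ?thesis using w Nil closed[OF w] by (simp add: nf_one)
qed

section \<open>Finiteness and completeness of the stacking relators\<close>

abbreviation base_relators where
  "base_relators \<equiv> {c (g, a) @ [\<iota> a] | g a. (g, a) \<in> recursive}"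

lemma base_relators_in_lists: "base_relators \<subseteq> lists A"
  using recursive_edgeD inv_closed by auto

lemma val_base_relators: "r \<in> base_relators \<Longrightarrow> val r = \<one>"
  using recursive_edgeD inv_closed by (fastforce simp: val_append letter_value_closed letter_value_inverse)

text \<open>There may be infinitely many recursive edges, but a relator depends only on the label of
  the edge and on the value of \<open>c\<close>, and both range over finite sets.\<close>

lemma finite_base_relators:
  assumes "finite A"
  shows "finite base_relators"
proof (rule finite_subset)
  show "base_relators \<subseteq> (\<lambda>(w, a). w @ [\<iota> a]) ` (c ` recursive \<times> A)"
    using recursive_edgeD(2) by force
  show "finite ((\<lambda>(w, a). w @ [\<iota> a]) ` (c ` recursive \<times> A))"
    using assms stacking by (auto simp: is_stacking_def)
qed

text \<open>Completeness is where rewriting to normal forms enters: a word of value one agrees in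
  the quotient with the normal form of the identity, the empty word, and hence lies in the relator
  subgroup.\<close>

lemma stacking_relators_presentation:
  "is_presentation G A \<iota> \<pi> (stacking_relators G A \<iota> \<pi> N c)"
proof (rule is_presentationI)
  let ?R = "stacking_relators G A \<iota> \<pi> N c"
  let ?M = "relator_subgroup A \<iota> ?R"
  show "\<exists>w\<in>lists A. val w = g" if "g \<in> carrier G" for g
    using that val_nf nf_in_lists by blast
  show R: "?R \<subseteq> lists A"
    using relator_closure_in_lists[OF _ base_relators_in_lists] by (auto simp: stacking_relators_def)
  show "val r = \<one>" if "r \<in> ?R" for r
    using that val_relator_closure[OF _ base_relators_in_lists val_base_relators]
    by (auto simp: stacking_relators_def)
  fix w assume w: "w \<in> lists A" "val w = \<one>"
  interpret F: group free_group by (rule group_free_group)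
  have RF: "word_class ` ?R \<subseteq> carrier free_group"
    using R word_class_in_carrier by blast
  interpret M: normal ?M free_group
    unfolding relator_subgroup_def by (rule F.normal_closure_normal[OF RF])
  have one: "?M #>\<^bsub>free_group\<^esub> word_class u = \<one>\<^bsub>free_group Mod ?M\<^esub>"
    if "word_class u \<in> ?M" for u
    using that F.coset_join2 M.is_subgroup M.subset by (auto simp: FactGroup_def)
  have "?M #>\<^bsub>free_group\<^esub> word_class w = ?M #>\<^bsub>free_group\<^esub> word_class (nf (val w))"
  proof (rule word_equals_nf[OF M.factorgroup_is_group _ _ _ _ w(1)])
    fix a assume "a \<in> A"
    then have "word_class [a, \<iota> a] = \<one>\<^bsub>free_group\<^esub>"
      using word_class_cancel[of "[]" "[]" a] by (simp add: one_free_group)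
    then show "?M #>\<^bsub>free_group\<^esub> word_class [a, \<iota> a] = \<one>\<^bsub>free_group Mod ?M\<^esub>"
      using M.one_closed by (intro one) simp
  next
    fix g a assume "(g, a) \<in> recursive"
    \<comment> \<open>The final letter makes this word nonempty, so it survives the removal of
      \<open>[]\<close> from the closure.\<close>
    then have "c (g, a) @ [\<iota> a] \<in> ?R"
      by (auto simp: stacking_relators_def intro: relator_closure.base)
    then show "?M #>\<^bsub>free_group\<^esub> word_class (c (g, a) @ [\<iota> a]) = \<one>\<^bsub>free_group Mod ?M\<^esub>"
      using F.subset_normal_closure[OF RF] by (intro one) (auto simp: relator_subgroup_def)
  next
    fix u v assume "u \<in> lists A" "v \<in> lists A"
    then show "?M #>\<^bsub>free_group\<^esub> word_class (u @ v) =
      (?M #>\<^bsub>free_group\<^esub> word_class u) \<otimes>\<^bsub>free_group Mod ?M\<^esub> (?M #>\<^bsub>free_group\<^esub> word_class v)"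
      by (simp add: FactGroup_def M.rcos_sum word_class_in_carrier word_class_mult)
  qed (auto simp: FactGroup_def RCOSETS_def word_class_in_carrier)
  also have "\<dots> = ?M"
    using w(2) F.coset_mult_one[OF M.subset] by (simp add: nf_one one_free_group)
  \<comment> \<open>The coset of \<open>w\<close> is the subgroup itself, and it contains the class
    of \<open>w\<close>.\<close>
  finally show "word_class w \<in> ?M"
    using F.rcos_self[OF word_class_in_carrier[OF w(1)] M.is_subgroup] by simp
qed

end

theorem lemma1p5:
  fixes G :: "('g, 'm) monoid_scheme"
    and A :: "'a set"
    and \<iota> :: "'a \<Rightarrow> 'a"
    and \<pi> :: "'a \<Rightarrow> 'g"
    and N :: "'a list set"
    and c :: "'g \<times> 'a \<Rightarrow> 'a list"
  assumes "symmetric_generating_set G A \<iota> \<pi>"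
    and "finite A"
    and "is_stacking G A \<iota> \<pi> N c"
  shows "is_finite_presentation G A \<iota> \<pi> (stacking_relators G A \<iota> \<pi> N c) \<and>
         (\<forall>w\<in>N. \<forall>u. prefix u w \<longrightarrow> u \<in> N)"
proof -
  interpret stacking G A \<iota> \<pi> N c
    using assms by (simp add: stacking_def stacking_axioms_def)
  have "finite (stacking_relators G A \<iota> \<pi> N c)"
    unfolding stacking_relators_def
    using finite_relator_closure[OF assms(2) finite_base_relators base_relators_in_lists] assms(2)
    by simp
  then show ?thesis
    using assms(2) stacking_relators_presentation N_prefix_closed
    by (simp add: is_finite_presentation_def)
qed

end
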